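(* Let $(\Omega, \mathcal{R})$ be a $Q$-bipartite $d$-class association scheme (i.e., its Krein parameters satisfy $q_{ij}^h = 0$ whenever $i+j+h$ is odd), with simultaneous eigenspaces $V_0, V_1,\ldots,V_d$ (where $V_0=\langle \mathds{1}\rangle$), and let $\theta$ be a nontrivial subset of the vertices, such that \[ \chi_\theta \in V_0 \perp \left(\perp_{i \in S} V_i\right), \] where $S \subseteq \{1, \ldots, d \}$, such that $i$ is odd for all $i \in S$. Then $|\theta|=\frac{1}{2}|\Omega|$.
   Context: Here $\chi_\theta$ is the characteristic vector of $\theta$, $\perp$ denotes orthogonal direct sum of subspaces, and $\perp_{i \in S} V_i$ denotes the orthogonal direct sum of the eigenspaces $V_i$ for $i\in S$. Nontrivial means $\theta$ is neither empty nor all of $\Omega$. *)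

theory Defs
  imports "HOL-Analysis.Analysis"
begin

text \<open>
  The vertex set is the finite type \<open>'v\<close>. Association schemes are symmetric, which is the
  setting in which the simultaneous eigenspaces are subspaces of real Euclidean space.
\<close>

definition assoc_scheme :: "nat \<Rightarrow> (nat \<Rightarrow> ('v::finite) rel) \<Rightarrow> bool" where
  "assoc_scheme d R \<longleftrightarrow>
     R 0 = Id \<and>
     (\<forall>i\<le>d. R i \<noteq> {}) \<and>
     (\<forall>i\<le>d. \<forall>j\<le>d. i \<noteq> j \<longrightarrow> R i \<inter> R j = {}) \<and>
     (\<Union>i\<le>d. R i) = UNIV \<and>
     (\<forall>i\<le>d. sym (R i)) \<and>
     (\<forall>i\<le>d. \<forall>j\<le>d. \<forall>k\<le>d. \<exists>p. \<forall>(x, y)\<in>R k. card {z. (x, z) \<in> R i \<and> (z, y) \<in> R j} = p)"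

definition adjacency_matrix :: "('v::finite) rel \<Rightarrow> real^'v^'v" where
  "adjacency_matrix r = (\<chi> x y. if (x, y) \<in> r then 1 else 0)"

definition common_eigenspace ::
  "nat \<Rightarrow> (nat \<Rightarrow> ('v::finite) rel) \<Rightarrow> (nat \<Rightarrow> real) \<Rightarrow> (real^'v) set" where
  "common_eigenspace d R l = {v. \<forall>i\<le>d. adjacency_matrix (R i) *v v = l i *\<^sub>R v}"

definition simultaneous_eigenspaces ::
  "nat \<Rightarrow> (nat \<Rightarrow> ('v::finite) rel) \<Rightarrow> (real^'v) set set" where
  "simultaneous_eigenspaces d R = {W. (\<exists>l. W = common_eigenspace d R l) \<and> W \<noteq> {0}}"

text \<open>
  \<open>V 0, \<dots>, V d\<close> lists the simultaneous eigenspaces without repetition, starting with the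
  span of the all-ones vector \<open>1\<close>.
\<close>

definition eigenspace_ordering ::
  "nat \<Rightarrow> (nat \<Rightarrow> ('v::finite) rel) \<Rightarrow> (nat \<Rightarrow> (real^'v) set) \<Rightarrow> bool" where
  "eigenspace_ordering d R V \<longleftrightarrow>
     bij_betw V {..d} (simultaneous_eigenspaces d R) \<and> V 0 = span {1}"

definition orth_projection :: "(real^'v) set \<Rightarrow> real^('v::finite)^'v" where
  "orth_projection W = (THE E. \<forall>v. E *v v \<in> W \<and> (\<forall>w\<in>W. orthogonal (v - E *v v) w))"

definition hadamard :: "real^'v^'v \<Rightarrow> real^'v^'v \<Rightarrow> real^('v::finite)^'v" where
  "hadamard A B = (\<chi> x y. A $ x $ y * B $ x $ y)"

text \<open>
  \<open>q i j h\<close> is the Krein parameter \<open>q\<^sub>i\<^sub>j\<^sup>h\<close>: with \<open>E\<^sub>i\<close> the primitive idempotent projecting onto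
  \<open>V i\<close> and \<open>n\<close> the number of vertices, \<open>E\<^sub>i \<circ> E\<^sub>j = (1/n) \<Sum>\<^sub>h q\<^sub>i\<^sub>j\<^sup>h E\<^sub>h\<close>. For an association
  scheme these equations have exactly one solution for indices up to \<open>d\<close>.
\<close>

definition krein_parameters ::
  "nat \<Rightarrow> (nat \<Rightarrow> (real^('v::finite)) set) \<Rightarrow> (nat \<Rightarrow> nat \<Rightarrow> nat \<Rightarrow> real) \<Rightarrow> bool" where
  "krein_parameters d V q \<longleftrightarrow>
     (\<forall>i\<le>d. \<forall>j\<le>d.
        hadamard (orth_projection (V i)) (orth_projection (V j)) =
        (1 / real CARD('v)) *\<^sub>R (\<Sum>h\<le>d. q i j h *\<^sub>R orth_projection (V h)))"

definition Q_bipartite :: "nat \<Rightarrow> (nat \<Rightarrow> nat \<Rightarrow> nat \<Rightarrow> real) \<Rightarrow> bool" where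
  "Q_bipartite d q \<longleftrightarrow> (\<forall>i\<le>d. \<forall>j\<le>d. \<forall>h\<le>d. odd (i + j + h) \<longrightarrow> q i j h = 0)"

definition char_vector :: "('v::finite) set \<Rightarrow> real^'v" where
  "char_vector \<theta> = (\<chi> x. indicator \<theta> x)"

end

theory Submission imports Defs begin

text \<open>
  If \<open>q\<^sub>i\<^sub>j\<^sup>h = 0\<close>, then the sum of all entries of \<open>E\<^sub>i \<circ> E\<^sub>j \<circ> E\<^sub>h\<close> vanishes. Writing each
  \<open>E\<close> as \<open>E E\<^sup>T\<close> turns this sum into a sum of squares, so \<open>\<Sum>\<^sub>x u\<^sub>x v\<^sub>x w\<^sub>x = 0\<close> for all
  \<open>u \<in> V\<^sub>i\<close>, \<open>v \<in> V\<^sub>j\<close>, \<open>w \<in> V\<^sub>h\<close>. In the Q-bipartite case this applies to all odd indices,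
  hence \<open>w = \<chi>\<^sub>\<theta> - c 1\<close>, the odd part of the characteristic vector, satisfies both
  \<open>\<Sum>\<^sub>x w\<^sub>x = 0\<close> and \<open>\<Sum>\<^sub>x w\<^sub>x\<^sup>3 = 0\<close>. With \<open>k = |\<theta>|\<close> and \<open>n = |\<Omega>|\<close> the first gives
  \<open>c = k / n\<close>, and then the second gives \<open>(1 - c)\<^sup>2 = c\<^sup>2\<close>.
\<close>

section \<open>Orthogonal projection matrices\<close>

lemma orth_decomposition_unique:
  fixes W :: "'a::real_inner set"
  assumes "subspace W" "a \<in> W" "b \<in> W"
    and "\<forall>w\<in>W. orthogonal (v - a) w" "\<forall>w\<in>W. orthogonal (v - b) w"
  shows "a = b"
proof -
  have "a - b \<in> W" using assms by (simp add: subspace_diff)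
  then have "(v - a) \<bullet> (a - b) = 0" "(v - b) \<bullet> (a - b) = 0"
    using assms by (auto simp: orthogonal_def)
  then have "(a - b) \<bullet> (a - b) = 0" by (simp add: inner_diff_left)
  then show ?thesis by simp
qed

text \<open>Since \<open>orth_projection\<close> is a definite description of a matrix, both
  existence and uniqueness are needed before anything can be read off from it. Uniqueness of
  orthogonal decompositions serves twice: it makes the pointwise choice \<open>f\<close> linear,
  hence given by a matrix, and it forces any other candidate to agree with that matrix.\<close>

lemma orth_projection_props:
  fixes W :: "(real^'v::finite) set"
  assumes W: "subspace W"
  shows "orth_projection W *v v \<in> W"
    and "w \<in> W \<Longrightarrow> orthogonal (v - orth_projection W *v v) w"
proof -
  have "\<exists>a. a \<in> W \<and> (\<forall>w\<in>W. orthogonal (v - a) w)" for v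
  proof -
    obtain y z where "y \<in> span W" "\<And>w. w \<in> span W \<Longrightarrow> orthogonal z w" "v = y + z"
      using orthogonal_subspace_decomp_exists[of W v] by blast
    moreover have "span W = W" using W by simp
    ultimately show ?thesis by (intro exI[of _ y]) auto
  qed
  then obtain f where f: "\<And>v. f v \<in> W" "\<And>v. \<forall>w\<in>W. orthogonal (v - f v) w" by metis
  have "linear f"
  proof
    fix x y
    show "f (x + y) = f x + f y"
    proof (rule orth_decomposition_unique[OF W, where v = "x + y"])
      show "\<forall>w\<in>W. orthogonal (x + y - (f x + f y)) w"
        using f(2)[of x] f(2)[of y]
        by (auto simp: orthogonal_def inner_diff_left inner_add_left)
    qed (use f W in \<open>auto simp: subspace_add\<close>)
  next
    fix r :: real and x
    show "f (r *\<^sub>R x) = r *\<^sub>R f x"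
    proof (rule orth_decomposition_unique[OF W, where v = "r *\<^sub>R x"])
      show "\<forall>w\<in>W. orthogonal (r *\<^sub>R x - r *\<^sub>R f x) w"
        using f(2)[of x] by (auto simp: orthogonal_def inner_diff_left)
    qed (use f W in \<open>auto simp: subspace_scale\<close>)
  qed
  then have mf: "matrix f *v v = f v" for v by simp
  have "\<forall>v. orth_projection W *v v \<in> W \<and> (\<forall>w\<in>W. orthogonal (v - orth_projection W *v v) w)"
    unfolding orth_projection_def
  proof (rule theI)
    show "\<forall>v. matrix f *v v \<in> W \<and> (\<forall>w\<in>W. orthogonal (v - matrix f *v v) w)"
      using f by (simp add: mf)
  next
    fix E :: "real^'v^'v"
    assume E: "\<forall>v. E *v v \<in> W \<and> (\<forall>w\<in>W. orthogonal (v - E *v v) w)"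
    then have "E *v v = matrix f *v v" for v
      by (intro orth_decomposition_unique[OF W, where v = v]) (auto simp: mf f)
    then show "E = matrix f" by (simp add: matrix_eq)
  qed
  then show "orth_projection W *v v \<in> W"
    and "w \<in> W \<Longrightarrow> orthogonal (v - orth_projection W *v v) w" by blast+
qed

lemma orth_projection_fixes:
  fixes W :: "(real^'v::finite) set"
  assumes "subspace W" "v \<in> W"
  shows "orth_projection W *v v = v"
  by (rule orth_decomposition_unique[OF assms(1) _ assms(2), where v = v])
    (simp_all add: orth_projection_props[OF assms(1)] orthogonal_clauses)

lemma orth_projection_eq_0:
  fixes W :: "(real^'v::finite) set"
  assumes "subspace W" "\<forall>w\<in>W. orthogonal v w"
  shows "orth_projection W *v v = 0"
  by (rule orth_decomposition_unique[OF assms(1), where v = v])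
    (simp_all add: orth_projection_props[OF assms(1)] subspace_0 assms)

lemma orth_projection_idem:
  fixes W :: "(real^'v::finite) set"
  assumes "subspace W"
  shows "orth_projection W ** orth_projection W = orth_projection W"
  using assms
  by (simp add: matrix_eq orth_projection_fixes orth_projection_props(1) flip: matrix_vector_mul_assoc)

lemma orth_projection_mult_eq_0:
  fixes U W :: "(real^'v::finite) set"
  assumes "subspace U" "subspace W" "\<And>u w. u \<in> U \<Longrightarrow> w \<in> W \<Longrightarrow> orthogonal u w"
  shows "orth_projection U ** orth_projection W = 0"
proof -
  have "orth_projection U *v (orth_projection W *v v) = 0" for v
    using assms orth_projection_props(1)[OF assms(2)]
    by (intro orth_projection_eq_0) (auto simp: orthogonal_commute)
  then show ?thesis by (simp add: matrix_eq flip: matrix_vector_mul_assoc)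
qed

text \<open>Entries have the form \<open>u \<bullet> (?E *v v)\<close> for axis vectors, and this
  equals \<open>(?E *v u) \<bullet> (?E *v v)\<close>, which is symmetric in \<open>u\<close> and
  \<open>v\<close>.\<close>

lemma orth_projection_sym:
  fixes W :: "(real^'v::finite) set"
  assumes W: "subspace W"
  shows "orth_projection W $ x $ y = orth_projection W $ y $ x"
proof -
  let ?E = "orth_projection W"
  \<comment> \<open>The residual \<open>u - ?E *v u\<close> is orthogonal to \<open>W\<close>, which
    contains \<open>?E *v v\<close>.\<close>
  have *: "u \<bullet> (?E *v v) = (?E *v u) \<bullet> (?E *v v)" for u v
    using orth_projection_props(2)[OF W orth_projection_props(1)[OF W], of u v]
    by (simp add: orthogonal_def inner_diff_left)
  have entry: "?E $ a $ b = axis a 1 \<bullet> (?E *v axis b 1)" for a b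
    by (simp add: inner_axis' matrix_vector_mul_component inner_axis)
  show ?thesis unfolding entry
    by (metis * inner_commute)
qed

section \<open>Simultaneous eigenspaces\<close>

lemma subspace_common_eigenspace: "subspace (common_eigenspace d R l)"
  by (auto simp: subspace_def common_eigenspace_def matrix_vector_right_distrib
      scaleR_right_distrib matrix_vector_mult_scaleR)

lemma adjacency_matrix_self_adjoint:
  assumes "sym r"
  shows "(adjacency_matrix r *v u) \<bullet> v = u \<bullet> (adjacency_matrix r *v v)"
proof -
  have "transpose (adjacency_matrix r) = adjacency_matrix r"
    using assms by (auto simp: transpose_def adjacency_matrix_def vec_eq_iff dest: symD)
  then show ?thesis
    by (metis dot_lmul_matrix transpose_matrix_vector)
qed

lemma eigenspace_ordering_subspace:
  assumes "eigenspace_ordering d R V" "i \<le> d"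
  shows "subspace (V i)"
proof -
  have "V i \<in> simultaneous_eigenspaces d R"
    using assms by (auto simp: eigenspace_ordering_def bij_betw_def)
  then obtain l where "V i = common_eigenspace d R l"
    unfolding simultaneous_eigenspaces_def by blast
  then show ?thesis by (simp only: subspace_common_eigenspace)
qed

text \<open>Different eigenspaces are separated by the eigenvalues of some relation
  \<open>R h\<close>, and a symmetric matrix has orthogonal eigenvectors for distinct
  eigenvalues.\<close>

lemma eigenspaces_orthogonal:
  assumes A: "assoc_scheme d R" and V: "eigenspace_ordering d R V"
    and ij: "i \<le> d" "j \<le> d" "i \<noteq> j" and uv: "u \<in> V i" "v \<in> V j"
  shows "orthogonal u v"
proof -
  have "V i \<in> simultaneous_eigenspaces d R" "V j \<in> simultaneous_eigenspaces d R"
    using V ij by (auto simp: eigenspace_ordering_def bij_betw_def)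
  then obtain l m where lm: "V i = common_eigenspace d R l" "V j = common_eigenspace d R m"
    by (auto simp: simultaneous_eigenspaces_def)
  have "V i \<noteq> V j"
    using V ij by (auto simp: eigenspace_ordering_def bij_betw_def inj_on_def)
  \<comment> \<open>Eigenvalue functions that agree up to \<open>d\<close> define the same common
    eigenspace.\<close>
  then have "\<exists>h\<le>d. l h \<noteq> m h"
    unfolding lm common_eigenspace_def by force
  then obtain h where h: "h \<le> d" "l h \<noteq> m h" by blast
  have "sym (R h)" using A h by (simp add: assoc_scheme_def)
  moreover have "adjacency_matrix (R h) *v u = l h *\<^sub>R u" "adjacency_matrix (R h) *v v = m h *\<^sub>R v"
    using uv h lm by (auto simp: common_eigenspace_def)
  ultimately have "l h * (u \<bullet> v) = m h * (u \<bullet> v)"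
    using adjacency_matrix_self_adjoint[of "R h" u v] by simp
  then show ?thesis using h by (simp add: orthogonal_def)
qed

section \<open>Krein parameters and triple products\<close>

lemma sum_rotate3:
  "(\<Sum>x\<in>X. \<Sum>a\<in>A. \<Sum>b\<in>B. g x a b) = (\<Sum>a\<in>A. \<Sum>b\<in>B. \<Sum>x\<in>X. g x a b)"
  by (subst sum.swap) (intro sum.cong refl sum.swap)

lemma sum_rotate4:
  "(\<Sum>x\<in>X. \<Sum>a\<in>A. \<Sum>b\<in>B. \<Sum>c\<in>C. g x a b c) = (\<Sum>a\<in>A. \<Sum>b\<in>B. \<Sum>c\<in>C. \<Sum>x\<in>X. g x a b c)"
  by (subst sum.swap) (intro sum.cong refl sum_rotate3)

lemma sum_product3:
  fixes f g h :: "_ \<Rightarrow> _::comm_semiring_0"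
  shows "sum f A * sum g B * sum h C = (\<Sum>a\<in>A. \<Sum>b\<in>B. \<Sum>c\<in>C. f a * g b * h c)"
  by (subst sum_product, subst sum_distrib_right, subst sum_distrib_right)
    (simp only: sum_distrib_left)

text \<open>Symmetry of the second factor turns the entry sum of a Hadamard product into the trace
  of the matrix product, where orthogonality of eigenspaces can be used.\<close>

lemma sum_orth_projection_times_orth_projection:
  fixes U W :: "(real^'v::finite) set"
  assumes "subspace W"
  shows "(\<Sum>x\<in>UNIV. \<Sum>y\<in>UNIV. orth_projection U $ x $ y * orth_projection W $ x $ y)
    = (\<Sum>x\<in>UNIV. (orth_projection U ** orth_projection W) $ x $ x)"
  by (simp add: matrix_matrix_mult_def orth_projection_sym[OF assms])

text \<open>The Krein equations expand the first two factors into a combination of the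
  \<open>?E l\<close>, leaving traces of \<open>?E l ** ?E h\<close>. For
  \<open>l \<noteq> h\<close> the product is zero by orthogonality; for \<open>l = h\<close> the
  coefficient is \<open>q i j h\<close>.\<close>

lemma sum_triple_hadamard_eq_0:
  fixes V :: "nat \<Rightarrow> (real^'v::finite) set"
  assumes A: "assoc_scheme d R" and V: "eigenspace_ordering d R V"
    and K: "krein_parameters d V q"
    and ijh: "i \<le> d" "j \<le> d" "h \<le> d" and q: "q i j h = 0"
  shows "(\<Sum>x\<in>UNIV. \<Sum>y\<in>UNIV. orth_projection (V i) $ x $ y * orth_projection (V j) $ x $ y
            * orth_projection (V h) $ x $ y) = 0"
proof -
  let ?E = "\<lambda>i. orth_projection (V i)"
  have "?E i $ x $ y * ?E j $ x $ y = (1 / real CARD('v)) * (\<Sum>l\<le>d. q i j l * ?E l $ x $ y)" for x y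
  proof -
    have "hadamard (?E i) (?E j) $ x $ y
        = ((1 / real CARD('v)) *\<^sub>R (\<Sum>l\<le>d. q i j l *\<^sub>R ?E l)) $ x $ y"
      using K ijh unfolding krein_parameters_def by simp
    then show ?thesis by (simp add: hadamard_def)
  qed
  then have "(\<Sum>x\<in>UNIV. \<Sum>y\<in>UNIV. ?E i $ x $ y * ?E j $ x $ y * ?E h $ x $ y)
     = (\<Sum>x\<in>UNIV. \<Sum>y\<in>UNIV. \<Sum>l\<le>d. 1 / real CARD('v) * q i j l * (?E l $ x $ y * ?E h $ x $ y))"
    by (simp add: sum_distrib_left sum_distrib_right mult.assoc)
  also have "\<dots> = (\<Sum>l\<le>d. \<Sum>x\<in>UNIV. \<Sum>y\<in>UNIV. 1 / real CARD('v) * q i j l * (?E l $ x $ y * ?E h $ x $ y))"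
    by (rule sum_rotate3[symmetric])
  also have "\<dots> = (\<Sum>l\<le>d. 1 / real CARD('v) * q i j l * (\<Sum>x\<in>UNIV. \<Sum>y\<in>UNIV. ?E l $ x $ y * ?E h $ x $ y))"
    by (simp only: sum_distrib_left)
  also have "\<dots> = 0"
  proof (rule sum.neutral, rule ballI)
    fix l assume "l \<in> {..d}"
    then have l: "l \<le> d" by simp
    show "1 / real CARD('v) * q i j l * (\<Sum>x\<in>UNIV. \<Sum>y\<in>UNIV. ?E l $ x $ y * ?E h $ x $ y) = 0"
    proof (cases "l = h")
      case False
      then have "?E l ** ?E h = 0"
        using eigenspaces_orthogonal[OF A V l ijh(3)] eigenspace_ordering_subspace[OF V] l ijh
        by (intro orth_projection_mult_eq_0) auto
      then show ?thesis
        using eigenspace_ordering_subspace[OF V ijh(3)]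
        by (simp add: sum_orth_projection_times_orth_projection)
    qed (simp add: q)
  qed
  finally show ?thesis .
qed

text \<open>After expanding the Gram entries, each summand factors into a part in \<open>x\<close>
  and the same part in \<open>y\<close>. For fixed \<open>a\<close>, \<open>b\<close>,
  \<open>c\<close> the double sum over \<open>x\<close> and \<open>y\<close> is therefore a
  square.\<close>

lemma sum_triple_product_gram:
  fixes A B C :: "real^'n::finite^'m::finite"
  shows "(\<Sum>x\<in>UNIV. \<Sum>y\<in>UNIV. (A ** transpose A) $ x $ y * (B ** transpose B) $ x $ y
            * (C ** transpose C) $ x $ y)
    = (\<Sum>a\<in>UNIV. \<Sum>b\<in>UNIV. \<Sum>c\<in>UNIV. (\<Sum>x\<in>UNIV. A $ x $ a * B $ x $ b * C $ x $ c)\<^sup>2)"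
proof -
  let ?g = "\<lambda>x a b c. A $ x $ a * B $ x $ b * C $ x $ c"
  have "(\<Sum>x\<in>UNIV. \<Sum>y\<in>UNIV. (A ** transpose A) $ x $ y * (B ** transpose B) $ x $ y
            * (C ** transpose C) $ x $ y)
     = (\<Sum>x\<in>UNIV. \<Sum>y\<in>UNIV. \<Sum>a\<in>UNIV. \<Sum>b\<in>UNIV. \<Sum>c\<in>UNIV. ?g x a b c * ?g y a b c)"
    unfolding matrix_matrix_mult_def transpose_def vec_lambda_beta sum_product3
    by (simp only: mult_ac)
  also have "\<dots> = (\<Sum>x\<in>UNIV. \<Sum>a\<in>UNIV. \<Sum>b\<in>UNIV. \<Sum>c\<in>UNIV. \<Sum>y\<in>UNIV. ?g x a b c * ?g y a b c)"
    by (intro sum.cong refl sum_rotate4)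
  also have "\<dots> = (\<Sum>a\<in>UNIV. \<Sum>b\<in>UNIV. \<Sum>c\<in>UNIV. \<Sum>x\<in>UNIV. \<Sum>y\<in>UNIV. ?g x a b c * ?g y a b c)"
    by (rule sum_rotate4)
  finally show ?thesis by (simp add: power2_eq_square sum_product)
qed

lemma eigenvector_triple_product_eq_0:
  fixes V :: "nat \<Rightarrow> (real^'v::finite) set"
  assumes A: "assoc_scheme d R" and V: "eigenspace_ordering d R V"
    and K: "krein_parameters d V q"
    and ijh: "i \<le> d" "j \<le> d" "h \<le> d" and q: "q i j h = 0"
    and uvw: "u \<in> V i" "v \<in> V j" "w \<in> V h"
  shows "(\<Sum>x\<in>UNIV. u $ x * v $ x * w $ x) = 0"
proof -
  let ?E = "\<lambda>i. orth_projection (V i)"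
  note sub = eigenspace_ordering_subspace[OF V]
  \<comment> \<open>A symmetric idempotent is its own Gram matrix, so the sum-of-squares identity
    applies to the projections.\<close>
  have gram: "?E k ** transpose (?E k) = ?E k" if "k \<le> d" for k
  proof -
    have "transpose (?E k) = ?E k"
      using orth_projection_sym[OF sub[OF that]] by (simp add: transpose_def vec_eq_iff)
    then show ?thesis using orth_projection_idem[OF sub[OF that]] by simp
  qed
  let ?T = "\<lambda>a b c. \<Sum>x\<in>UNIV. ?E i $ x $ a * ?E j $ x $ b * ?E h $ x $ c"
  have "(\<Sum>a\<in>UNIV. \<Sum>b\<in>UNIV. \<Sum>c\<in>UNIV. (?T a b c)\<^sup>2) = 0"
    using sum_triple_hadamard_eq_0[OF A V K ijh q] sum_triple_product_gram[of "?E i" "?E j" "?E h"]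
      gram ijh by simp
  then have T0: "?T a b c = 0" for a b c
    by (simp add: sum_nonneg_eq_0_iff sum_nonneg)
  \<comment> \<open>Vectors of \<open>V k\<close> are fixed by \<open>?E k\<close>. This writes the
    triple product of \<open>u\<close>, \<open>v\<close>, \<open>w\<close> as a linear combination
    of the vanishing sums \<open>?T a b c\<close>.\<close>
  have expand: "t $ x = (\<Sum>a\<in>UNIV. ?E k $ x $ a * t $ a)" if "k \<le> d" "t \<in> V k" for k t x
    using orth_projection_fixes[OF sub[OF that(1)] that(2)]
    by (metis (no_types, lifting) matrix_vector_mult_def vec_lambda_beta sum.cong)
  have "(\<Sum>x\<in>UNIV. u $ x * v $ x * w $ x)
      = (\<Sum>x\<in>UNIV. \<Sum>a\<in>UNIV. \<Sum>b\<in>UNIV. \<Sum>c\<in>UNIV.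
          u $ a * v $ b * w $ c * (?E i $ x $ a * ?E j $ x $ b * ?E h $ x $ c))"
  proof (rule sum.cong[OF refl])
    fix x
    have "u $ x * v $ x * w $ x = (\<Sum>a\<in>UNIV. ?E i $ x $ a * u $ a)
        * (\<Sum>a\<in>UNIV. ?E j $ x $ a * v $ a) * (\<Sum>a\<in>UNIV. ?E h $ x $ a * w $ a)"
      by (simp only: expand[OF ijh(1) uvw(1), of x, symmetric] expand[OF ijh(2) uvw(2), of x, symmetric]
          expand[OF ijh(3) uvw(3), of x, symmetric])
    also have "\<dots> = (\<Sum>a\<in>UNIV. \<Sum>b\<in>UNIV. \<Sum>c\<in>UNIV.
          u $ a * v $ b * w $ c * (?E i $ x $ a * ?E j $ x $ b * ?E h $ x $ c))"
      unfolding sum_product3 by (simp only: mult_ac)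
    finally show "u $ x * v $ x * w $ x = \<dots>" .
  qed
  also have "\<dots> = (\<Sum>a\<in>UNIV. \<Sum>b\<in>UNIV. \<Sum>c\<in>UNIV. \<Sum>x\<in>UNIV.
          u $ a * v $ b * w $ c * (?E i $ x $ a * ?E j $ x $ b * ?E h $ x $ c))"
    by (rule sum_rotate4)
  also have "\<dots> = (\<Sum>a\<in>UNIV. \<Sum>b\<in>UNIV. \<Sum>c\<in>UNIV. u $ a * v $ b * w $ c * ?T a b c)"
    by (simp only: sum_distrib_left)
  also have "\<dots> = 0" by (simp only: T0) simp
  finally show ?thesis .
qed

text \<open>The triple product is linear in each argument, so span induction replaces generators by
  span elements one argument at a time: first \<open>u\<close>, then \<open>v\<close>, then
  \<open>w\<close>. The weight \<open>g\<close> collects the two arguments held fixed.\<close>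

lemma triple_product_eq_0_span:
  fixes B :: "(real^'v::finite) set"
  assumes B: "\<And>u v w. u \<in> B \<Longrightarrow> v \<in> B \<Longrightarrow> w \<in> B \<Longrightarrow> (\<Sum>x\<in>UNIV. u $ x * v $ x * w $ x) = 0"
    and "u \<in> span B" "v \<in> span B" "w \<in> span B"
  shows "(\<Sum>x\<in>UNIV. u $ x * v $ x * w $ x) = 0"
proof -
  have sub1: "subspace {u :: real^'v. (\<Sum>x\<in>UNIV. u $ x * g x) = 0}" for g
    by (simp add: subspace_def distrib_right sum.distrib mult.assoc flip: sum_distrib_left)
  have ext: "(\<Sum>x\<in>UNIV. t $ x * g x) = 0"
    if "t \<in> span B" "\<And>s. s \<in> B \<Longrightarrow> (\<Sum>x\<in>UNIV. s $ x * g x) = 0" for t g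
    using that(1) sub1[of g] that(2) by (rule span_induct)
  have 1: "(\<Sum>x\<in>UNIV. b $ x * (u $ x * c $ x)) = 0" if "b \<in> B" "c \<in> B" for b c
  proof -
    have "(\<Sum>x\<in>UNIV. u $ x * (b $ x * c $ x)) = 0"
      by (rule ext[OF assms(2)]) (use B that in \<open>simp flip: mult.assoc\<close>)
    then show ?thesis by (simp only: mult.left_commute)
  qed
  have 2: "(\<Sum>x\<in>UNIV. c $ x * (u $ x * v $ x)) = 0" if "c \<in> B" for c
  proof -
    have "(\<Sum>x\<in>UNIV. v $ x * (u $ x * c $ x)) = 0"
      by (rule ext[OF assms(3)]) (use 1 that in blast)
    then show ?thesis by (simp only: mult_ac)
  qed
  have "(\<Sum>x\<in>UNIV. w $ x * (u $ x * v $ x)) = 0"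
    by (rule ext[OF assms(4) 2])
  then show ?thesis by (simp only: mult_ac)
qed

section \<open>Counting and conclusion\<close>

lemma sum_split_indicator:
  fixes f :: "real \<Rightarrow> real" and \<theta> :: "'v::finite set"
  shows "(\<Sum>x\<in>UNIV. f (indicator \<theta> x)) = real (card \<theta>) * f 1 + (real CARD('v) - real (card \<theta>)) * f 0"
proof -
  have "(\<Sum>x\<in>UNIV. f (indicator \<theta> x)) = (\<Sum>x\<in>\<theta>. f (indicator \<theta> x)) + (\<Sum>x\<in>-\<theta>. f (indicator \<theta> x))"
    by (metis Compl_eq_Diff_UNIV add.commute finite subset_UNIV sum.subset_diff)
  also have "\<dots> = real (card \<theta>) * f 1 + real (card (-\<theta>)) * f 0" by simp
  finally show ?thesis by (simp add: Compl_eq_Diff_UNIV card_Diff_subset of_nat_diff card_mono)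
qed

theorem theorem4p4:
  fixes R :: "nat \<Rightarrow> ('v::finite) rel"
    and V :: "nat \<Rightarrow> (real^'v) set"
    and q :: "nat \<Rightarrow> nat \<Rightarrow> nat \<Rightarrow> real"
    and d :: nat
    and S :: "nat set"
    and \<theta> :: "'v set"
  assumes "assoc_scheme d R"
    and "eigenspace_ordering d R V"
    and "krein_parameters d V q"
    and "Q_bipartite d q"
    and "\<theta> \<noteq> {}" and "\<theta> \<noteq> UNIV"
    and "S \<subseteq> {1..d}" and "\<forall>i\<in>S. odd i"
    and "char_vector \<theta> \<in> span (V 0 \<union> (\<Union>i\<in>S. V i))"
  shows "real (card \<theta>) = 1 / 2 * real CARD('v)"
proof -
  let ?B = "\<Union>i\<in>S. V i"
  have V0: "V 0 = span {1}" using assms(2) by (simp add: eigenspace_ordering_def)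
  obtain c w where w: "w \<in> span ?B" and chi: "char_vector \<theta> = c *\<^sub>R 1 + w"
    using assms(9) unfolding span_Un V0 span_span by (auto simp: span_singleton)
  have wx: "w $ x = indicator \<theta> x - c" for x
    using arg_cong[OF chi, of "\<lambda>v. v $ x"] by (simp add: char_vector_def)
  \<comment> \<open>Indices in \<open>S\<close> are at least 1, so each \<open>V i\<close> with
    \<open>i \<in> S\<close> is orthogonal to \<open>V 0\<close>.\<close>
  have "orthogonal 1 w"
  proof (rule orthogonal_to_span[OF w])
    fix b assume "b \<in> ?B"
    then obtain i where i: "i \<in> S" "b \<in> V i" by blast
    have "(1 :: real^'v) \<in> V 0" unfolding V0 by (simp add: span_base)
    then show "orthogonal 1 b"
      using i assms(7) by (intro eigenspaces_orthogonal[OF assms(1,2), of 0 i]) auto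
  qed
  then have sum1: "(\<Sum>x\<in>UNIV. w $ x) = 0"
    by (simp add: orthogonal_def inner_vec_def)
  have sum3: "(\<Sum>x\<in>UNIV. w $ x * w $ x * w $ x) = 0"
  proof (rule triple_product_eq_0_span[OF _ w w w])
    fix a b e assume "a \<in> ?B" "b \<in> ?B" "e \<in> ?B"
    then obtain i j h where ijh: "i \<in> S" "j \<in> S" "h \<in> S" "a \<in> V i" "b \<in> V j" "e \<in> V h" by blast
    then have le: "i \<le> d" "j \<le> d" "h \<le> d" using assms(7) by auto
    \<comment> \<open>A sum of three odd indices is odd; this is where the parity assumption on
      \<open>S\<close> meets the Q-bipartite condition.\<close>
    have "odd (i + j + h)" using ijh assms(8) by simp
    then have "q i j h = 0" using le assms(4) by (simp add: Q_bipartite_def)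
    then show "(\<Sum>x\<in>UNIV. a $ x * b $ x * e $ x) = 0"
      using eigenvector_triple_product_eq_0[OF assms(1-3) le] ijh by blast
  qed
  define k n where "k = real (card \<theta>)" and "n = real CARD('v)"
  have k: "0 < k" "k < n"
    using assms(5,6) psubset_card_mono[of UNIV \<theta>] by (auto simp: k_def n_def card_gt_0_iff)
  have e1: "k * (1 - c) + (n - k) * (0 - c) = 0"
    using sum1 sum_split_indicator[of "\<lambda>t. t - c" \<theta>] by (simp add: wx k_def n_def)
  have e3: "k * (1 - c)^3 + (n - k) * (0 - c)^3 = 0"
    using sum3 sum_split_indicator[of "\<lambda>t. (t - c) * (t - c) * (t - c)" \<theta>]
    by (simp add: wx k_def n_def power3_eq_cube)
  have kc: "k = n * c" using e1 by (simp add: algebra_simps)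
  \<comment> \<open>With \<open>k = n * c\<close>, the cubic identity has the common factor
    \<open>n * c * (1 - c)\<close>, and the cofactor is
    \<open>(1 - c)^2 - c^2 = 1 - 2 * c\<close>.\<close>
  have "n * c * (1 - c) * (1 - 2 * c) = 0"
    using e3 unfolding kc by (simp add: algebra_simps power3_eq_cube)
  \<comment> \<open>Nontriviality of \<open>\<theta>\<close> gives \<open>0 < k < n\<close>, which
    excludes \<open>c = 0\<close> and \<open>c = 1\<close>.\<close>
  moreover have "n \<noteq> 0" "c \<noteq> 0" "1 - c \<noteq> 0" using k kc by auto
  ultimately have "c = 1 / 2" by simp
  then show ?thesis using kc by (simp add: k_def n_def)
qed

end
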